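(* Let $A\in\mathbb{R}$ with $|A|<\frac{3\sqrt3}{2}$. There exists $\epsilon_A>0$ such that for every $B\in(-\epsilon_A,\epsilon_A)$ there are constants $C_1$ and $C_2$ satisfying all the following conditions: (i) $C_2>C_1\ge 0$; (ii) $K_I(x,y)<0$ for all $x\in\mathbb{R}$ and $y\in(C_1,C_2)$; (iii) $K_I(x,y)>0$ for all $x\in\mathbb{R}$ and $y\in(-C_2,-C_1)$.
   Context: For real parameters $A,B$ and real $x,y$ with $y\neq0$, $$K_I(x,y)=-2\left(A\sinh y\cos x+B\cosh y\sin x+\frac{\sinh 2y}{\cosh 2y-\cos 2x}\right).$$ (This is the drift of the imaginary part $y$ in the complex Langevin process with gauge cooling for the $SU(2)$ Polyakov loop model with $\beta_1+\beta_2=A+\mathrm{i}B$.) *)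

theory Defs
  imports "HOL-Analysis.Analysis"
begin

(* For y \<noteq> 0 the denominator is positive.  At y = 0 it can vanish and the value there is
   only a by-product of HOL's totality (x / 0 = 0); it carries no meaning. *)
definition K_I :: "real \<Rightarrow> real \<Rightarrow> real \<Rightarrow> real \<Rightarrow> real" where
  "K_I A B x y =
     - 2 * (A * sinh y * cos x + B * cosh y * sin x
            + sinh (2 * y) / (cosh (2 * y) - cos (2 * x)))"

end

theory Submission
  imports Defs
begin

text \<open>
  With \<open>u = cos x\<close>, \<open>c = cosh y\<close>, \<open>s = sinh y\<close> and \<open>D = c\<^sup>2 - u\<^sup>2\<close>, the last summand of the drift is
  \<open>s c / D\<close>. The maximum of \<open>\<bar>u\<bar> (c\<^sup>2 - u\<^sup>2)\<close> over \<open>u\<close> is \<open>2 c\<^sup>3 / (3 \<surd>3)\<close>, so for \<open>c\<close> close to \<open>1\<close> the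
  bound on \<open>A\<close> gives \<open>\<bar>A u D\<bar> \<le> (1 - q) c\<close> with some \<open>q > 0\<close>. On an interval of such \<open>y\<close> bounded away
  from \<open>0\<close>, the remaining \<open>q s c\<close> dominates the \<open>B\<close>-term for small \<open>B\<close>. Negative \<open>y\<close> follow because
  the drift is odd under \<open>(x, y) \<mapsto> (-x, -y)\<close>.
\<close>

lemma K_I_minus_minus: "K_I A B (- x) (- y) = - K_I A B x y"
  by (simp add: K_I_def algebra_simps)

lemma cosh_sq_minus_cos_sq:
  fixes x y :: real
  shows "cosh (2 * y) - cos (2 * x) = 2 * ((cosh y)\<^sup>2 - (cos x)\<^sup>2)"
  by (simp add: cosh_double cos_double sinh_square_eq sin_squared_eq)

text \<open>With \<open>c = sqrt 3 * d\<close>, right minus left is \<open>3 * sqrt 3 / 2\<close>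
  times \<open>(\<bar>u\<bar> - d)\<^sup>2 * (\<bar>u\<bar> + 2 * d)\<close>, which is nonnegative;
  the double root \<open>\<bar>u\<bar> = d\<close> is the maximizer.\<close>

lemma abs_times_diff_squares_le:
  fixes u c :: real
  assumes "c \<ge> 0"
  shows "3 * sqrt 3 / 2 * (\<bar>u\<bar> * (c\<^sup>2 - u\<^sup>2)) \<le> c ^ 3"
proof -
  define d where "d = c / sqrt 3"
  have c: "c = sqrt 3 * d" and d: "d \<ge> 0"
    using assms by (auto simp: d_def)
  have "0 \<le> (\<bar>u\<bar> - d)\<^sup>2 * (\<bar>u\<bar> + 2 * d)"
    using d by simp
  also have "\<dots> = 2 * d ^ 3 - \<bar>u\<bar> * (3 * d\<^sup>2 - \<bar>u\<bar>\<^sup>2)"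
    by algebra
  finally have "\<bar>u\<bar> * (3 * d\<^sup>2 - u\<^sup>2) \<le> 2 * d ^ 3"
    by simp
  then have "3 * sqrt 3 / 2 * (\<bar>u\<bar> * (3 * d\<^sup>2 - u\<^sup>2)) \<le> 3 * sqrt 3 / 2 * (2 * d ^ 3)"
    by (intro mult_left_mono) auto
  also have "\<dots> = c ^ 3"
    by (simp add: c power_mult_distrib power3_eq_cube)
  finally show ?thesis
    by (simp add: c power_mult_distrib)
qed

text \<open>After multiplication by \<open>D > 0\<close>, the term \<open>s * c\<close> is split by
  \<open>q\<close>: the share \<open>(1 - q) * s * c\<close> absorbs the A-term, and
  \<open>q * s * c\<close> strictly dominates the B-term.\<close>

lemma K_I_neg:
  fixes A B q x y :: real
  assumes y: "y > 0"
    and A: "\<bar>A\<bar> * (cosh y)\<^sup>2 \<le> (1 - q) * (3 * sqrt 3 / 2)"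
    and B: "\<bar>B\<bar> * (cosh y)\<^sup>2 < q * sinh y"
  shows "K_I A B x y < 0"
proof -
  define u v c s D where "u = cos x" and "v = sin x" and "c = cosh y" and "s = sinh y"
    and "D = c\<^sup>2 - u\<^sup>2"
  define k :: real where "k = 3 * sqrt 3 / 2"
  have c: "c > 1" and s: "s > 0" and k: "k > 0"
    using y by (auto simp: c_def s_def k_def cosh_real_nonneg_less_iff[of 0 y, simplified])
  have "u\<^sup>2 \<le> 1"
    by (simp add: u_def abs_square_le_1)
  moreover have "c\<^sup>2 > 1"
    using c by simp
  ultimately have D: "0 < D" "D \<le> c\<^sup>2"
    by (auto simp: D_def)
  have "k * (\<bar>A\<bar> * (\<bar>u\<bar> * D)) \<le> \<bar>A\<bar> * c ^ 3"
    using mult_left_mono[OF abs_times_diff_squares_le[of c u], of "\<bar>A\<bar>"] c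
    by (simp add: k_def D_def mult_ac)
  also have "\<dots> = c * (\<bar>A\<bar> * c\<^sup>2)"
    by (simp add: power2_eq_square power3_eq_cube)
  also have "\<dots> \<le> c * ((1 - q) * k)"
    using A c by (intro mult_left_mono) (auto simp: c_def k_def)
  finally have "\<bar>A\<bar> * (\<bar>u\<bar> * D) \<le> c * (1 - q)"
    using k by simp
  moreover have "\<bar>A * u * D\<bar> = \<bar>A\<bar> * (\<bar>u\<bar> * D)"
    using D by (simp add: abs_mult)
  ultimately have "- (A * u * D) \<le> c * (1 - q)"
    by linarith
  from mult_left_mono[OF this, of s] s
  have 1: "A * s * u * D + s * c \<ge> s * c * q"
    by (simp add: algebra_simps)
  \<comment> \<open>The crude bounds \<open>\<bar>v\<bar> \<le> 1\<close> and
    \<open>D \<le> c\<^sup>2\<close> suffice, since \<open>B\<close> may be taken small.\<close>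
  have "\<bar>B * v * D\<bar> \<le> \<bar>B\<bar> * 1 * c\<^sup>2"
    unfolding abs_mult using D by (intro mult_mono) (auto simp: v_def)
  then have "- (B * v * D) < q * s"
    using B by (simp add: c_def s_def)
  from mult_strict_left_mono[OF this, of c] c
  have 2: "B * c * v * D > - (s * c * q)"
    by (simp add: algebra_simps)
  \<comment> \<open>The factor 2 of the denominator has to stay outside the difference to cancel
    against \<open>sinh (2 * y) = 2 * s * c\<close>.\<close>
  have "sinh (2 * y) / (cosh (2 * y) - cos (2 * x)) = s * c / D"
    by (simp add: cosh_sq_minus_cos_sq sinh_double s_def c_def u_def D_def
        del: right_diff_distrib_numeral)
  then have "K_I A B x y = - 2 * ((A * s * u * D + B * c * v * D + s * c) / D)"
    using D unfolding K_I_def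
    by (simp add: u_def v_def c_def s_def add_divide_distrib)
  moreover have "(A * s * u * D + B * c * v * D + s * c) / D > 0"
    using 1 2 D by (intro divide_pos_pos) linarith+
  ultimately show ?thesis
    by linarith
qed

theorem theorem5:
  fixes A :: real
  assumes "\<bar>A\<bar> < 3 * sqrt 3 / 2"
  shows "\<exists>\<epsilon>>0. \<forall>B\<in>{-\<epsilon><..<\<epsilon>}. \<exists>C\<^sub>1 C\<^sub>2 :: real.
           C\<^sub>2 > C\<^sub>1 \<and> C\<^sub>1 \<ge> 0 \<and>
           (\<forall>x. \<forall>y\<in>{C\<^sub>1<..<C\<^sub>2}. K_I A B x y < 0) \<and>
           (\<forall>x. \<forall>y\<in>{-C\<^sub>2<..<-C\<^sub>1}. K_I A B x y > 0)"
proof -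
  define k :: real where "k = 3 * sqrt 3 / 2"
  have k: "k > 0"
    by (simp add: k_def)
  \<comment> \<open>As \<open>cosh 0 = 1\<close>, the limit is \<open>\<bar>A\<bar> < k\<close>, so
    the strict bound survives at some \<open>C > 0\<close>.\<close>
  have "((\<lambda>y. \<bar>A\<bar> * (cosh y)\<^sup>2) \<longlongrightarrow> \<bar>A\<bar> * (cosh 0)\<^sup>2) (at_right (0::real))"
    by (intro tendsto_intros)
  then have "eventually (\<lambda>y. \<bar>A\<bar> * (cosh y)\<^sup>2 < k) (at_right 0)"
    by (rule order_tendstoD(2)) (use assms in \<open>simp add: k_def\<close>)
  then have "eventually (\<lambda>y. 0 < y \<and> \<bar>A\<bar> * (cosh y)\<^sup>2 < k) (at_right 0)"
    using eventually_at_right_less[of "0::real"] by eventually_elim auto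
  then obtain C where C: "C > 0" "\<bar>A\<bar> * (cosh C)\<^sup>2 < k"
    using eventually_happens'[OF trivial_limit_at_right_real] by blast
  \<comment> \<open>This \<open>q\<close> gives
    \<open>(1 - q) * k = \<bar>A\<bar> * (cosh C)\<^sup>2\<close>, the worst case over
    \<open>0 < y \<le> C\<close>.\<close>
  define q where "q = 1 - \<bar>A\<bar> * (cosh C)\<^sup>2 / k"
  have q: "q > 0"
    using C k by (simp add: q_def)
  \<comment> \<open>On the interval from \<open>C / 2\<close> to \<open>C\<close>,
    \<open>sinh\<close> is smallest at the left end and \<open>cosh\<close> largest at the right
    end, so one \<epsilon> serves every \<open>y\<close>.\<close>
  define \<epsilon> where "\<epsilon> = q * sinh (C / 2) / (cosh C)\<^sup>2"
  have \<epsilon>: "\<epsilon> > 0"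
    using q C by (simp add: \<epsilon>_def)
  have neg: "K_I A B x y < 0" if B: "\<bar>B\<bar> < \<epsilon>" and y: "C / 2 < y" "y < C" for B x y
  proof (rule K_I_neg)
    show "y > 0"
      using y C by linarith
    then have cosh_le: "(cosh y)\<^sup>2 \<le> (cosh C)\<^sup>2"
      using y by (intro power_mono) (auto simp: cosh_real_nonneg_le_iff)
    then have "\<bar>A\<bar> * (cosh y)\<^sup>2 \<le> \<bar>A\<bar> * (cosh C)\<^sup>2"
      by (intro mult_left_mono) auto
    also have "\<dots> = (1 - q) * k"
      using k by (simp add: q_def)
    finally show "\<bar>A\<bar> * (cosh y)\<^sup>2 \<le> (1 - q) * (3 * sqrt 3 / 2)"
      by (simp add: k_def)
    have "\<bar>B\<bar> * (cosh y)\<^sup>2 \<le> \<bar>B\<bar> * (cosh C)\<^sup>2"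
      using cosh_le by (intro mult_left_mono) auto
    also have "\<dots> < q * sinh (C / 2)"
      using B by (simp add: \<epsilon>_def pos_less_divide_eq)
    also have "\<dots> \<le> q * sinh y"
      using y q by (intro mult_left_mono) auto
    finally show "\<bar>B\<bar> * (cosh y)\<^sup>2 < q * sinh y" .
  qed
  have pos: "K_I A B x y > 0" if "\<bar>B\<bar> < \<epsilon>" "- C < y" "y < - (C / 2)" for B x y
    using neg[of B "- y" "- x"] that by (simp add: K_I_minus_minus)
  have "\<forall>B\<in>{-\<epsilon><..<\<epsilon>}. C > C / 2 \<and> C / 2 \<ge> 0 \<and>
      (\<forall>x. \<forall>y\<in>{C / 2<..<C}. K_I A B x y < 0) \<and>
      (\<forall>x. \<forall>y\<in>{-C<..<-(C / 2)}. K_I A B x y > 0)"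
    using neg pos C by (auto simp: abs_less_iff)
  with \<epsilon> show ?thesis
    by blast
qed

end
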